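(* Let $t\ge1$, let $k_1,\ldots,k_t\ge 2$ be integers and $\kappa:=\sum_{i=1}^t(k_i-1)$. If $G$ is a graph with $n$ vertices that does not contain $C_{2k_1,2k_2,\ldots,2k_t}$ as a subgraph, then $$\sum_{u\in V(G)} d_G(u)^2<(4\kappa+t)(n-1)n.$$
   Context: $d_G(u)$ is the degree of $u$ in $G$. $C_{2k_1,\ldots,2k_t}$ is the graph obtained from cycles $C_{2k_1},\ldots,C_{2k_t}$ intersecting in exactly one common vertex.
   Formalization: The hypothesis n ≥ 2 is added, since for n = 0 or n = 1 both sides of the strict inequality are 0 and the claim reads 0 < 0. *)

theory Defs
  imports Main
begin

definition simple_graph :: "'a set \<Rightarrow> 'a set set \<Rightarrow> bool" where
  "simple_graph V E \<longleftrightarrow> finite V \<and> (\<forall>e\<in>E. e \<subseteq> V \<and> card e = 2)"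

definition vertex_degree :: "'a set set \<Rightarrow> 'a \<Rightarrow> nat" where
  "vertex_degree E u = card {e \<in> E. u \<in> e}"

text \<open>Not necessarily induced containment of an isomorphic copy of \<open>(W, F)\<close> in \<open>(V, E)\<close>.\<close>

definition contains_subgraph :: "'a set \<Rightarrow> 'a set set \<Rightarrow> 'b set \<Rightarrow> 'b set set \<Rightarrow> bool" where
  "contains_subgraph V E W F \<longleftrightarrow>
     (\<exists>f. inj_on f W \<and> f ` W \<subseteq> V \<and> (\<forall>e\<in>F. f ` e \<in> E))"

text \<open>
  The graph \<open>C\<^bsub>2k\<^sub>1,\<dots>,2k\<^sub>t\<^esub>\<close>: the position \<open>j \<in> {0..2k\<^sub>i}\<close> on the \<open>i\<close>-th cycle is the
  common vertex \<open>None\<close> if \<open>j = 0\<close> or \<open>j = 2k\<^sub>i\<close>, and otherwise the vertex \<open>Some (i, j)\<close>,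
  which lies on the \<open>i\<close>-th cycle only.
\<close>

definition cyc_vertex :: "(nat \<Rightarrow> nat) \<Rightarrow> nat \<Rightarrow> nat \<Rightarrow> (nat \<times> nat) option" where
  "cyc_vertex k i j = (if j = 0 \<or> j = 2 * k i then None else Some (i, j))"

definition int_cycles_verts :: "nat \<Rightarrow> (nat \<Rightarrow> nat) \<Rightarrow> (nat \<times> nat) option set" where
  "int_cycles_verts t k = {cyc_vertex k i j |i j. i \<in> {1..t} \<and> j < 2 * k i}"

definition int_cycles_edges :: "nat \<Rightarrow> (nat \<Rightarrow> nat) \<Rightarrow> (nat \<times> nat) option set set" where
  "int_cycles_edges t k =
     {{cyc_vertex k i j, cyc_vertex k i (Suc j)} |i j. i \<in> {1..t} \<and> j < 2 * k i}"

lemma simple_graph_int_cycles: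
  assumes "\<And>i. i \<in> {1..t} \<Longrightarrow> 2 \<le> k i"
  shows "simple_graph (int_cycles_verts t k) (int_cycles_edges t k)"
proof -
  have "int_cycles_verts t k = (\<Union>i\<in>{1..t}. cyc_vertex k i ` {..<2 * k i})"
    unfolding int_cycles_verts_def by blast
  then have fin: "finite (int_cycles_verts t k)"
    by simp
  have "e \<subseteq> int_cycles_verts t k \<and> card e = 2" if mem: "e \<in> int_cycles_edges t k" for e
  proof -
    obtain i j where e: "e = {cyc_vertex k i j, cyc_vertex k i (Suc j)}"
      and i: "i \<in> {1..t}" and j: "j < 2 * k i"
      using mem unfolding int_cycles_edges_def by blast
    have k: "2 \<le> k i" using assms i by blast
    have "cyc_vertex k i j \<noteq> cyc_vertex k i (Suc j)"
      using k j unfolding cyc_vertex_def by auto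
    then have "card e = 2" using e by simp
    moreover have "cyc_vertex k i j \<in> int_cycles_verts t k"
      using i j unfolding int_cycles_verts_def by blast
    moreover have "cyc_vertex k i (Suc j) \<in> int_cycles_verts t k"
    proof (cases "Suc j = 2 * k i")
      case True
      then have "cyc_vertex k i (Suc j) = cyc_vertex k i 0"
        by (simp add: cyc_vertex_def)
      moreover have "0 < 2 * k i" using k by simp
      ultimately show ?thesis using i unfolding int_cycles_verts_def by blast
    next
      case False
      then have "Suc j < 2 * k i" using j by simp
      then show ?thesis using i unfolding int_cycles_verts_def by blast
    qed
    ultimately show ?thesis using e by simp
  qed
  with fin show ?thesis unfolding simple_graph_def by blast
qed

end

theory Submission imports Defs begin

text \<open>
  Since \<open>\<Sum>\<^sub>u d(u)\<^sup>2 = \<Sum>\<^sub>v \<Sum>\<^bsub>u \<in> N(v)\<^esub> d(u)\<close>, it suffices to show that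
  \<open>\<Sum>\<^bsub>u \<in> N(v)\<^esub> d(u) < (4\<kappa> + t)(n - 1)\<close> for every vertex \<open>v\<close>.
  Put \<open>A = N(v)\<close> and \<open>B = V - A - {v}\<close>. The graph contains the intersecting cycles, with \<open>v\<close> as
  common vertex, as soon as \<open>G - v\<close> has \<open>t\<close> disjoint paths with \<open>2k\<^sub>i - 1\<close> vertices and both ends in \<open>A\<close>.
  A path with \<open>2\<kappa> + t\<close> vertices inside \<open>A\<close> can be cut into such paths, so the Erdos-Gallai theorem
  bounds \<open>2e(A)\<close> by \<open>(2\<kappa> + t - 2)|A|\<close>. If \<open>e(A, B) > (\<kappa> - 1)|A| + (\<kappa> + t - 1)|B|\<close>, deleting vertices
  of low degree leaves a bipartite graph with degrees at least \<open>\<kappa>\<close> on the \<open>A\<close> side and at least \<open>\<kappa> + t\<close>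
  on the \<open>B\<close> side, in which the paths, using \<open>\<kappa> + t\<close> vertices of \<open>A\<close> and \<open>\<kappa>\<close> of \<open>B\<close>, are found greedily.
\<close>

section \<open>Neighbourhoods, paths and double counting\<close>

text \<open>A relation stands in for the edge set and \<open>S\<close> restricts the graph, so
  deleting vertices changes \<open>S\<close> only.\<close>

definition nbrs :: "('a \<Rightarrow> 'a \<Rightarrow> bool) \<Rightarrow> 'a set \<Rightarrow> 'a \<Rightarrow> 'a set" where
  "nbrs R S u = {w \<in> S. R u w}"

text \<open>A path is its list of vertices: \<open>length\<close> counts vertices, not edges, and
  the empty path is allowed.\<close>

definition path_in :: "('a \<Rightarrow> 'a \<Rightarrow> bool) \<Rightarrow> 'a set \<Rightarrow> 'a list \<Rightarrow> bool" where
  "path_in R S xs \<longleftrightarrow> distinct xs \<and> successively R xs \<and> set xs \<subseteq> S"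

lemma finite_nbrs [simp]: "finite S \<Longrightarrow> finite (nbrs R S u)"
  by (simp add: nbrs_def)

lemma card_nbrs_Un:
  assumes "finite S" "finite T" "S \<inter> T = {}"
  shows "card (nbrs R (S \<union> T) u) = card (nbrs R S u) + card (nbrs R T u)"
proof -
  have "nbrs R (S \<union> T) u = nbrs R S u \<union> nbrs R T u" "nbrs R S u \<inter> nbrs R T u = {}"
    using assms by (auto simp: nbrs_def)
  then show ?thesis using assms by (simp add: card_Un_disjoint)
qed

lemma card_nbrs_singleton: "card (nbrs R {w} u) = (if R u w then 1 else 0)"
proof -
  have "nbrs R {w} u = (if R u w then {w} else {})" by (auto simp: nbrs_def)
  then show ?thesis by simp
qed

lemma sum_card_nbrs_swap:
  assumes "symp R" "finite S" "finite T"
  shows "(\<Sum>u\<in>S. card (nbrs R T u)) = (\<Sum>w\<in>T. card (nbrs R S w))"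
proof -
  have "(\<Sum>u\<in>S. card (nbrs R T u)) = (\<Sum>u\<in>S. \<Sum>w\<in>T. if R u w then 1 else 0)"
    using assms by (simp add: nbrs_def sum.If_cases Int_def)
  also have "\<dots> = (\<Sum>w\<in>T. \<Sum>u\<in>S. if R w u then 1 else 0)"
    using assms(1) by (subst sum.swap) (auto intro!: sum.cong dest: sympD)
  also have "\<dots> = (\<Sum>w\<in>T. card (nbrs R S w))"
    using assms by (simp add: nbrs_def sum.If_cases Int_def)
  finally show ?thesis .
qed

text \<open>The cost of deleting one vertex, needed in both deletion arguments below. By symmetry
  the lost edges can be counted at \<open>w\<close>.\<close>

lemma sum_card_nbrs_remove:
  assumes "symp R" "finite S" "finite T" "w \<in> T"
  shows "(\<Sum>u\<in>S. card (nbrs R T u)) = (\<Sum>u\<in>S. card (nbrs R (T - {w}) u)) + card (nbrs R S w)"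
proof -
  have "card (nbrs R T u) = card (nbrs R (T - {w}) u) + card (nbrs R {w} u)" for u
    using card_nbrs_Un[of "T - {w}" "{w}" R u] assms by (simp add: insert_absorb)
  then have "(\<Sum>u\<in>S. card (nbrs R T u))
      = (\<Sum>u\<in>S. card (nbrs R (T - {w}) u)) + (\<Sum>u\<in>S. card (nbrs R {w} u))"
    by (simp add: sum.distrib)
  also have "(\<Sum>u\<in>S. card (nbrs R {w} u)) = card (nbrs R S w)"
    using sum_card_nbrs_swap[of R S "{w}"] assms by simp
  finally show ?thesis .
qed

section \<open>The Erdos-Gallai theorem for paths\<close>

text \<open>By pigeonhole, an edge from the first vertex to \<open>xs ! Suc i\<close> and one from the
  last vertex to \<open>xs ! i\<close> coexist; reversing the initial segment then closes the path to a cycle.\<close>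

lemma longest_path_closes_to_cycle:
  assumes "symp R" "irreflp R" "path_in R S xs" "xs \<noteq> []"
    and max: "\<And>ys. path_in R S ys \<Longrightarrow> length ys \<le> length xs"
    and deg: "length xs \<le> card (nbrs R S (hd xs)) + card (nbrs R S (last xs))"
  obtains ys where "path_in R S ys" "set ys = set xs" "length ys = length xs" "R (last ys) (hd ys)"
proof -
  let ?l = "length xs - 1"
  have p: "distinct xs" "successively R xs" "set xs \<subseteq> S"
    using assms(3) by (auto simp: path_in_def)
  have sym: "R y x" if "R x y" for x y using assms(1) that by (rule sympD)
  \<comment> \<open>Maximality keeps all neighbours of both ends on the path, so the two degrees can
    be counted by positions.\<close>
  have hd_nbrs: "w \<in> set xs" if "w \<in> S" "R (hd xs) w" for w
  proof (rule ccontr)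
    assume "w \<notin> set xs"
    then have "path_in R S (w # xs)"
      using p that sym by (auto simp: path_in_def successively_Cons)
    from max[OF this] show False by simp
  qed
  have last_nbrs: "w \<in> set xs" if "w \<in> S" "R (last xs) w" for w
  proof (rule ccontr)
    assume "w \<notin> set xs"
    then have "path_in R S (xs @ [w])"
      using p that by (auto simp: path_in_def successively_append_iff)
    from max[OF this] show False by simp
  qed
  define I where "I = {i. i < ?l \<and> R (hd xs) (xs ! Suc i)}"
  define J where "J = {i. i < ?l \<and> R (last xs) (xs ! i)}"
  have "nbrs R S (hd xs) \<subseteq> (\<lambda>i. xs ! Suc i) ` I"
  proof
    fix w assume "w \<in> nbrs R S (hd xs)"
    then have w: "R (hd xs) w" "w \<in> set xs" using hd_nbrs by (auto simp: nbrs_def)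
    then obtain j where j: "j < length xs" "w = xs ! j" by (auto simp: in_set_conv_nth)
    have "j \<noteq> 0"
      using w j \<open>xs \<noteq> []\<close> assms(2) by (metis hd_conv_nth irreflpD)
    then obtain i where "j = Suc i" by (cases j) auto
    with w j show "w \<in> (\<lambda>i. xs ! Suc i) ` I" by (auto simp: I_def)
  qed
  then have cI: "card (nbrs R S (hd xs)) \<le> card I"
    by (rule surj_card_le[rotated]) (simp add: I_def)
  have "nbrs R S (last xs) \<subseteq> (\<lambda>i. xs ! i) ` J"
  proof
    fix w assume "w \<in> nbrs R S (last xs)"
    then have w: "R (last xs) w" "w \<in> set xs" using last_nbrs by (auto simp: nbrs_def)
    then obtain j where j: "j < length xs" "w = xs ! j" by (auto simp: in_set_conv_nth)
    have "j \<noteq> ?l"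
      using w j \<open>xs \<noteq> []\<close> assms(2) by (metis last_conv_nth irreflpD)
    with w j show "w \<in> (\<lambda>i. xs ! i) ` J" by (auto simp: J_def)
  qed
  then have cJ: "card (nbrs R S (last xs)) \<le> card J"
    by (rule surj_card_le[rotated]) (simp add: J_def)
  have "I \<inter> J \<noteq> {}"
  proof
    assume "I \<inter> J = {}"
    then have "card I + card J = card (I \<union> J)"
      by (subst card_Un_disjoint) (auto simp: I_def J_def)
    also have "\<dots> \<le> card {..<?l}"
      by (rule card_mono) (auto simp: I_def J_def)
    finally have "card I + card J \<le> ?l" by simp
    then have "length xs \<le> ?l" using cI cJ deg by linarith
    then show False using \<open>xs \<noteq> []\<close> by (cases xs) auto
  qed
  then obtain i where i: "i < ?l" "R (hd xs) (xs ! Suc i)" "R (last xs) (xs ! i)"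
    by (auto simp: I_def J_def)
  \<comment> \<open>The cut falls between positions \<open>i\<close> and \<open>Suc i\<close>. The
    edge from \<open>hd xs\<close> joins the reversed \<open>as\<close> to \<open>bs\<close>, and
    the edge from \<open>last xs\<close> closes the cycle.\<close>
  define as where "as = take (Suc i) xs"
  define bs where "bs = drop (Suc i) xs"
  have ab: "xs = as @ bs" by (simp add: as_def bs_def)
  have ne: "as \<noteq> []" "bs \<noteq> []" using i \<open>xs \<noteq> []\<close> by (auto simp: as_def bs_def)
  have la: "last as = xs ! i" using i by (simp add: as_def take_Suc_conv_app_nth)
  have hb: "hd bs = xs ! Suc i" using i by (simp add: bs_def hd_drop_conv_nth)
  have "successively R (rev as)"
    using p(2) ab sym by (auto simp: successively_append_iff elim: successively_mono)
  moreover have "R (hd as) (hd bs)" using i hb ab ne by (simp add: hd_append)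
  ultimately have "path_in R S (rev as @ bs)"
    using p ab ne by (auto simp: path_in_def successively_append_iff last_rev)
  moreover have "R (last (rev as @ bs)) (hd (rev as @ bs))"
    using i la ab ne by (simp add: hd_append hd_rev)
  ultimately show thesis using that[of "rev as @ bs"] ab by auto
qed

text \<open>Opening the cycle at \<open>u\<close> and putting an outside neighbour in front would
  give a longer path. Hence no edge leaves the cycle.\<close>

lemma nbrs_subset_cycle_on_longest_path:
  assumes "symp R" "irreflp R" "path_in R S ys" "R (last ys) (hd ys)"
    and max: "\<And>zs. path_in R S zs \<Longrightarrow> length zs \<le> length ys"
    and u: "u \<in> set ys"
  shows "nbrs R S u \<subseteq> set ys - {u}"
proof
  fix z assume z: "z \<in> nbrs R S u"
  have "z \<noteq> u" using z assms(2) by (auto simp: nbrs_def irreflp_def)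
  moreover have "z \<in> set ys"
  proof (rule ccontr)
    assume nz: "z \<notin> set ys"
    obtain as bs where ab: "ys = as @ u # bs" using u by (auto simp: in_set_conv_decomp)
    have "R z u" using z assms(1) by (auto simp: nbrs_def dest: sympD)
    \<comment> \<open>The closing edge is crossed between \<open>bs\<close> and \<open>as\<close>.
      It starts at \<open>u\<close> if \<open>bs\<close> is empty and is not crossed if
      \<open>as\<close> is empty.\<close>
    then have "path_in R S (z # u # bs @ as)"
      using assms(3,4) nz z ab
      by (cases "as = []"; cases "bs = []")
         (auto simp: path_in_def nbrs_def successively_append_iff successively_Cons)
    from max[OF this] show False using ab by simp
  qed
  ultimately show "z \<in> set ys - {u}" by simp
qed

text \<open>Induction on \<open>S\<close>; the sum is twice the number of edges. A vertex of degree
  at most \<open>(m - 1) / 2\<close> can be deleted. If there is none, a longest path closes to a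
  cycle that no edge leaves; it has at most \<open>m\<close> vertices, so their degrees are at most
  \<open>m - 1\<close>, and it is deleted as a whole.\<close>

theorem erdos_gallai_path:
  assumes "symp R" "irreflp R" "finite S" "1 \<le> m"
    and "\<And>xs. path_in R S xs \<Longrightarrow> length xs \<le> m"
  shows "(\<Sum>u\<in>S. card (nbrs R S u)) \<le> (m - 1) * card S"
  using assms(3,5)
proof (induction S rule: finite_psubset_induct)
  case (psubset S)
  have mono: "path_in R T xs \<Longrightarrow> T \<subseteq> S \<Longrightarrow> length xs \<le> m" for T xs
    using psubset.prems[of xs] by (auto simp: path_in_def)
  consider "S = {}" | w where "w \<in> S" "2 * card (nbrs R S w) \<le> m - 1"
    | "S \<noteq> {}" "\<And>w. w \<in> S \<Longrightarrow> m \<le> 2 * card (nbrs R S w)"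
    by force
  then show ?case
  proof cases
    case 1
    then show ?thesis by simp
  next
    case (2 w)
    let ?S = "S - {w}"
    have IH: "(\<Sum>u\<in>?S. card (nbrs R ?S u)) \<le> (m - 1) * card ?S"
      by (rule psubset.IH) (use 2 mono in auto)
    have "nbrs R ?S w = nbrs R S w"
      using assms(2) by (auto simp: nbrs_def irreflp_def)
    \<comment> \<open>The factor 2 combines the degree of \<open>w\<close> with its contribution to
      the degrees of the others.\<close>
    then have "(\<Sum>u\<in>S. card (nbrs R S u))
        = (\<Sum>u\<in>?S. card (nbrs R ?S u)) + 2 * card (nbrs R S w)"
      using sum_card_nbrs_remove[of R ?S S w] sum.remove[of S w "\<lambda>u. card (nbrs R S u)"]
        2 assms(1) psubset.hyps by simp
    also have "\<dots> \<le> (m - 1) * card ?S + (m - 1)" using IH 2 by simp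
    also have "\<dots> = (m - 1) * card S"
      using card.remove[OF psubset.hyps(1) 2(1)] by simp
    finally show ?thesis .
  next
    case 3
    obtain x where x: "x \<in> S" using 3 by blast
    \<comment> \<open>The one-vertex path shows that paths exist. The bound is \<open>Suc m\<close>
      because the greatest-element rule wants a strict one.\<close>
    have "\<exists>xs. path_in R S xs \<and> (\<forall>ys. path_in R S ys \<longrightarrow> length ys \<le> length xs)"
      using psubset.prems x
      by (intro ex_has_greatest_nat[where k = "[x]" and b = "Suc m"])
        (auto simp: path_in_def less_Suc_eq_le)
    then obtain xs where xs: "path_in R S xs"
      and max: "\<And>ys. path_in R S ys \<Longrightarrow> length ys \<le> length xs" by blast
    have ne: "xs \<noteq> []" using max[of "[x]"] x by (auto simp: path_in_def)
    have m: "length xs \<le> m" using psubset.prems xs by blast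
    have "hd xs \<in> S" "last xs \<in> S" using xs ne by (auto simp: path_in_def)
    then have "m \<le> 2 * card (nbrs R S (hd xs))" "m \<le> 2 * card (nbrs R S (last xs))"
      using 3 by auto
    then have "length xs \<le> card (nbrs R S (hd xs)) + card (nbrs R S (last xs))"
      using m by linarith
    then obtain ys where ys: "path_in R S ys" "set ys = set xs" "length ys = length xs"
        "R (last ys) (hd ys)"
      using longest_path_closes_to_cycle[OF assms(1,2) xs ne max] by blast
    let ?C = "set ys" and ?S = "S - set ys"
    have CS: "?C \<subseteq> S" using ys by (auto simp: path_in_def)
    have Cnb: "nbrs R S u \<subseteq> ?C - {u}" if "u \<in> ?C" for u
      using nbrs_subset_cycle_on_longest_path[OF assms(1,2) ys(1,4)] max ys that by simp
    have cC: "card (nbrs R S u) \<le> m - 1" if "u \<in> ?C" for u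
    proof -
      have "card (nbrs R S u) \<le> card (?C - {u})" using Cnb[OF that] by (simp add: card_mono)
      also have "\<dots> \<le> m - 1" using that card_length[of ys] m ys by simp
      finally show ?thesis .
    qed
    have "?C \<noteq> {}" using ys ne by auto
    then have "?S \<subset> S" using CS by (metis Diff_disjoint Diff_subset inf.absorb2 psubsetI Int_commute)
    then have IH: "(\<Sum>u\<in>?S. card (nbrs R ?S u)) \<le> (m - 1) * card ?S"
      by (rule psubset.IH) (use mono in auto)
    \<comment> \<open>By symmetry no edge enters the cycle from outside, so its deletion changes no
      other degree.\<close>
    have same: "nbrs R S u = nbrs R ?S u" if "u \<in> ?S" for u
      using that Cnb assms(1) by (auto simp: nbrs_def dest: sympD)
    have "(\<Sum>u\<in>S. card (nbrs R S u)) = (\<Sum>u\<in>?S. card (nbrs R S u)) + (\<Sum>u\<in>?C. card (nbrs R S u))"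
      using CS psubset.hyps by (simp add: sum.subset_diff)
    also have "(\<Sum>u\<in>?S. card (nbrs R S u)) = (\<Sum>u\<in>?S. card (nbrs R ?S u))"
      using same by simp
    also have "(\<Sum>u\<in>?C. card (nbrs R S u)) \<le> (m - 1) * card ?C"
      using sum_bounded_above[of ?C "\<lambda>u. card (nbrs R S u)" "m - 1"] cC by (simp add: mult.commute)
    also have "(\<Sum>u\<in>?S. card (nbrs R ?S u)) + (m - 1) * card ?C \<le> (m - 1) * (card ?S + card ?C)"
      using IH by (simp add: algebra_simps)
    also have "card ?S + card ?C = card S"
      using CS psubset.hyps by (metis card_Diff_subset card_mono finite_set le_add_diff_inverse2)
    finally show ?thesis by simp
  qed
qed

section \<open>Bipartite graphs of large minimum degree and alternating paths\<close>

text \<open>Deleting a vertex of \<open>A\<close> of degree at most \<open>p\<close>, or one of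
  \<open>B\<close> of degree at most \<open>q\<close>, lowers the right side of the edge inequality
  by no more than the left side. The inequality survives, and being strict it leaves
  \<open>A\<close> nonempty when the deletions stop.\<close>

lemma bipartite_min_degree_subgraph:
  assumes "symp R" "finite A" "finite B"
    and "p * card A + q * card B < (\<Sum>u\<in>A. card (nbrs R B u))"
  obtains X Y where "X \<subseteq> A" "Y \<subseteq> B" "X \<noteq> {}"
    "\<And>x. x \<in> X \<Longrightarrow> p < card (nbrs R Y x)" "\<And>y. y \<in> Y \<Longrightarrow> q < card (nbrs R X y)"
  using assms(2-)
proof (induction "card A + card B" arbitrary: A B thesis rule: less_induct)
  case less
  note fin = \<open>finite A\<close> \<open>finite B\<close>
  consider x where "x \<in> A" "card (nbrs R B x) \<le> p" | y where "y \<in> B" "card (nbrs R A y) \<le> q"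
    | "\<And>x. x \<in> A \<Longrightarrow> p < card (nbrs R B x)" "\<And>y. y \<in> B \<Longrightarrow> q < card (nbrs R A y)"
    by force
  then show ?case
  proof cases
    case (1 x)
    have c: "card A = Suc (card (A - {x}))" using card.remove[OF fin(1) 1(1)] .
    have "(\<Sum>u\<in>A. card (nbrs R B u)) = card (nbrs R B x) + (\<Sum>u\<in>A - {x}. card (nbrs R B u))"
      using fin 1 by (simp add: sum.remove)
    then have edges: "p * card (A - {x}) + q * card B < (\<Sum>u\<in>A - {x}. card (nbrs R B u))"
      using less.prems(4) 1(2) unfolding c mult_Suc_right by linarith
    have smaller: "card (A - {x}) + card B < card A + card B" using c by linarith
    show ?thesis
    proof (rule less.hyps[OF smaller _ finite_Diff[OF fin(1)] fin(2) edges])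
      fix X Y assume "X \<subseteq> A - {x}" "Y \<subseteq> B" and XY: "X \<noteq> {}"
        "\<And>x. x \<in> X \<Longrightarrow> p < card (nbrs R Y x)" "\<And>y. y \<in> Y \<Longrightarrow> q < card (nbrs R X y)"
      then have "X \<subseteq> A" "Y \<subseteq> B" by auto
      then show thesis using XY by (rule less.prems(1))
    qed
  next
    case (2 y)
    have c: "card B = Suc (card (B - {y}))" using card.remove[OF fin(2) 2(1)] .
    have "(\<Sum>u\<in>A. card (nbrs R B u)) = (\<Sum>u\<in>A. card (nbrs R (B - {y}) u)) + card (nbrs R A y)"
      using sum_card_nbrs_remove fin 2 assms(1) by metis
    then have edges: "p * card A + q * card (B - {y}) < (\<Sum>u\<in>A. card (nbrs R (B - {y}) u))"
      using less.prems(4) 2(2) unfolding c mult_Suc_right by linarith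
    have smaller: "card A + card (B - {y}) < card A + card B" using c by linarith
    show ?thesis
    proof (rule less.hyps[OF smaller _ fin(1) finite_Diff[OF fin(2)] edges])
      fix X Y assume "X \<subseteq> A" "Y \<subseteq> B - {y}" and XY: "X \<noteq> {}"
        "\<And>x. x \<in> X \<Longrightarrow> p < card (nbrs R Y x)" "\<And>y. y \<in> Y \<Longrightarrow> q < card (nbrs R X y)"
      then have "X \<subseteq> A" "Y \<subseteq> B" by auto
      then show thesis using XY by (rule less.prems(1))
    qed
  next
    case 3
    have "A \<noteq> {}" using less.prems(4) by auto
    then show ?thesis using less.prems(1)[of A B] 3 by blast
  qed
qed

text \<open>The greedy choice: \<open>M\<close> holds the candidates on the side \<open>N\<close>,
  and only the used vertices on that side can block them.\<close>

lemma exists_mem_avoiding: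
  assumes "finite M" "M \<subseteq> N" "card (U \<inter> N) < card M" "finite N"
  obtains w where "w \<in> M" "w \<notin> U"
proof -
  have "\<not> M \<subseteq> U \<inter> N" using assms card_mono[of "U \<inter> N" M] by auto
  then show thesis using that assms(2) by blast
qed

text \<open>Greedy extension at the front by a vertex of \<open>Y\<close> and then one of
  \<open>X\<close>, avoiding the used set \<open>U\<close>. The two inequalities say that each
  side's degree exceeds the number of vertices already taken on the opposite side whenever a
  neighbour is chosen; \<open>a \<le> card X\<close> provides the first vertex.\<close>

lemma alternating_path:
  assumes "symp R" "finite X" "finite Y" "X \<inter> Y = {}"
    and degX: "\<And>x. x \<in> X \<Longrightarrow> b \<le> card (nbrs R Y x)"
    and degY: "\<And>y. y \<in> Y \<Longrightarrow> a \<le> card (nbrs R X y)"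
    and "a \<le> card X" "card (U \<inter> X) + Suc k \<le> a" "card (U \<inter> Y) + k \<le> b"
  shows "\<exists>xs. path_in R (X \<union> Y) xs \<and> length xs = 2 * k + 1 \<and> hd xs \<in> X \<and> last xs \<in> X \<and>
    set xs \<inter> U = {} \<and> card (set xs \<inter> X) = Suc k \<and> card (set xs \<inter> Y) = k"
  using assms(8,9)
proof (induction k)
  case 0
  have "card (U \<inter> X) < card X" using 0 assms(7) by simp
  then obtain x where x: "x \<in> X" "x \<notin> U" using exists_mem_avoiding[of X X U] assms(2) by blast
  moreover have "{x} \<inter> X = {x}" "{x} \<inter> Y = {}" using x assms(4) by auto
  ultimately show ?case
    by (intro exI[of _ "[x]"]) (simp add: path_in_def)
next
  case (Suc k)
  then obtain xs where xs: "path_in R (X \<union> Y) xs" "length xs = 2 * k + 1" "hd xs \<in> X" "last xs \<in> X"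
    "set xs \<inter> U = {}" "card (set xs \<inter> X) = Suc k" "card (set xs \<inter> Y) = k"
    by (metis Suc_leD add_Suc_right)
  have split: "card ((set xs \<union> U) \<inter> Z) = card (set xs \<inter> Z) + card (U \<inter> Z)" if "finite Z" for Z
  proof -
    have "(set xs \<union> U) \<inter> Z = set xs \<inter> Z \<union> U \<inter> Z" by blast
    then show ?thesis using xs(5) that by (subst card_Un_disjoint[symmetric]) auto
  qed
  have "card ((set xs \<union> U) \<inter> Y) < card (nbrs R Y (hd xs))"
    using split[OF assms(3)] xs Suc.prems degX[OF xs(3)] by simp
  then obtain y where y: "y \<in> nbrs R Y (hd xs)" "y \<notin> set xs \<union> U"
    using exists_mem_avoiding[of "nbrs R Y (hd xs)" Y] assms(3) by (auto simp: nbrs_def)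
  then have yY: "y \<in> Y" by (simp add: nbrs_def)
  have "card ((set xs \<union> U) \<inter> X) < card (nbrs R X y)"
    using split[OF assms(2)] xs Suc.prems degY[OF yY] by simp
  then obtain x where x: "x \<in> nbrs R X y" "x \<notin> set xs \<union> U"
    using exists_mem_avoiding[of "nbrs R X y" X] assms(2) by (auto simp: nbrs_def)
  then have xX: "x \<in> X" by (simp add: nbrs_def)
  have "xs \<noteq> []" "x \<noteq> y" using xs(2) xX yY assms(4) by auto
  moreover have "R x y" "R y (hd xs)" using x y assms(1) by (auto simp: nbrs_def dest: sympD)
  ultimately have "path_in R (X \<union> Y) (x # y # xs)"
    using xs(1) x y xX yY by (auto simp: path_in_def successively_Cons)
  moreover have "set (x # y # xs) \<inter> X = insert x (set xs \<inter> X)"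
    "set (x # y # xs) \<inter> Y = insert y (set xs \<inter> Y)"
    using xX yY assms(4) by auto
  then have "card (set (x # y # xs) \<inter> X) = Suc (Suc k)" "card (set (x # y # xs) \<inter> Y) = Suc k"
    using xs x y by simp_all
  ultimately show ?case
    using xs x y xX \<open>xs \<noteq> []\<close> by (intro exI[of _ "x # y # xs"]) simp
qed

section \<open>Systems of disjoint paths\<close>

text \<open>These are the cycles with the common vertex removed, which leaves
  \<open>2 * k i - 1\<close> vertices on each; \<open>A\<close> plays the part of its
  neighbourhood.\<close>

definition path_system ::
  "('a \<Rightarrow> 'a \<Rightarrow> bool) \<Rightarrow> 'a set \<Rightarrow> 'a set \<Rightarrow> nat \<Rightarrow> (nat \<Rightarrow> nat) \<Rightarrow> (nat \<Rightarrow> 'a list) \<Rightarrow> bool" where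
  "path_system R S A t k P \<longleftrightarrow>
     (\<forall>i\<in>{1..t}. path_in R S (P i) \<and> length (P i) = 2 * k i - 1 \<and> hd (P i) \<in> A \<and> last (P i) \<in> A) \<and>
     (\<forall>i\<in>{1..t}. \<forall>j\<in>{1..t}. i \<noteq> j \<longrightarrow> set (P i) \<inter> set (P j) = {})"

lemma path_system_extend:
  assumes "path_system R S A t k P" "path_in R S xs" "length xs = 2 * k (Suc t) - 1"
    "hd xs \<in> A" "last xs \<in> A" "\<And>i. i \<in> {1..t} \<Longrightarrow> set xs \<inter> set (P i) = {}"
  shows "path_system R S A (Suc t) k (P(Suc t := xs))"
proof -
  have *: "i \<in> {1..Suc t} \<longleftrightarrow> i \<in> {1..t} \<or> i = Suc t" for i by auto
  have **: "i \<noteq> Suc t" if "i \<in> {1..t}" for i using that by auto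
  show ?thesis
    using assms unfolding path_system_def Ball_def * by (auto simp: ** Int_commute)
qed

lemma path_system_mono:
  assumes "path_system R S A t k P" "S \<subseteq> S'" "A \<subseteq> A'"
  shows "path_system R S' A' t k P"
  using assms unfolding path_system_def path_in_def by blast

text \<open>Cut the path into consecutive pieces, the last index taking the front one. Ends are
  automatically admissible since \<open>A = S\<close>; the inclusion in \<open>set xs\<close>
  carries disjointness through the induction.\<close>

lemma path_system_from_long_path:
  assumes "\<And>i. i \<in> {1..t} \<Longrightarrow> 1 \<le> k i"
    and "path_in R S xs" "(\<Sum>i=1..t. 2 * k i - 1) \<le> length xs"
  shows "\<exists>P. path_system R S S t k P \<and> (\<forall>i\<in>{1..t}. set (P i) \<subseteq> set xs)"
  using assms
proof (induction t arbitrary: xs)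
  case 0
  then show ?case by (simp add: path_system_def)
next
  case (Suc t)
  let ?m = "2 * k (Suc t) - 1"
  let ?as = "take ?m xs" and ?bs = "drop ?m xs"
  have len: "?m \<le> length xs" "(\<Sum>i=1..t. 2 * k i - 1) \<le> length ?bs" using Suc.prems(3) by auto
  \<comment> \<open>An empty piece would have unspecified \<open>hd\<close> and
    \<open>last\<close>.\<close>
  have m: "?m \<noteq> 0" using Suc.prems(1)[of "Suc t"] by simp
  have ab: "path_in R S (?as @ ?bs)" using Suc.prems(2) by simp
  then have as: "path_in R S ?as" and bs: "path_in R S ?bs" and dj: "set ?as \<inter> set ?bs = {}"
    unfolding path_in_def successively_append_iff by (auto simp del: append_take_drop_id)
  obtain P where P: "path_system R S S t k P" "\<forall>i\<in>{1..t}. set (P i) \<subseteq> set ?bs"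
    using Suc.IH[OF _ bs len(2)] Suc.prems(1) by auto
  have ne: "?as \<noteq> []" using m len by auto
  then have "hd ?as \<in> S" "last ?as \<in> S"
    using as hd_in_set[OF ne] last_in_set[OF ne] unfolding path_in_def by blast+
  then have "path_system R S S (Suc t) k (P(Suc t := ?as))"
  proof (intro path_system_extend as P)
    show "length ?as = ?m" using len by simp
    show "set ?as \<inter> set (P i) = {}" if "i \<in> {1..t}" for i using P(2) dj that by blast
  qed
  moreover have "set ((P(Suc t := ?as)) i) \<subseteq> set xs" if "i \<in> {1..Suc t}" for i
    using P(2) that set_take_subset[of ?m xs] set_drop_subset[of ?m xs]
    by (cases "i = Suc t") (auto simp: le_Suc_eq dest!: bspec)
  ultimately show ?case by blast
qed

text \<open>Path \<open>i\<close> takes \<open>k i\<close> vertices of \<open>X\<close> and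
  \<open>k i - 1\<close> of \<open>Y\<close>, so the degree bounds equal the total consumption and
  the greedy choice never gets stuck.\<close>

lemma path_system_bipartite:
  assumes "symp R" "finite X" "finite Y" "X \<inter> Y = {}"
    and degX: "\<And>x. x \<in> X \<Longrightarrow> (\<Sum>i=1..t. k i - 1) \<le> card (nbrs R Y x)"
    and degY: "\<And>y. y \<in> Y \<Longrightarrow> (\<Sum>i=1..t. k i) \<le> card (nbrs R X y)"
    and "(\<Sum>i=1..t. k i) \<le> card X"
    and k: "\<And>i. i \<in> {1..t} \<Longrightarrow> 1 \<le> k i"
  shows "\<exists>P. path_system R (X \<union> Y) X t k P"
proof -
  \<comment> \<open>The induction also records how many vertices of each side are used up.\<close>
  have "\<exists>P. path_system R (X \<union> Y) X s k P \<and>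
      card ((\<Union>i\<in>{1..s}. set (P i)) \<inter> X) \<le> (\<Sum>i=1..s. k i) \<and>
      card ((\<Union>i\<in>{1..s}. set (P i)) \<inter> Y) \<le> (\<Sum>i=1..s. k i - 1)" if "s \<le> t" for s
    using that
  proof (induction s)
    case 0
    then show ?case by (simp add: path_system_def)
  next
    case (Suc s)
    then obtain P where P: "path_system R (X \<union> Y) X s k P"
      "card ((\<Union>i\<in>{1..s}. set (P i)) \<inter> X) \<le> (\<Sum>i=1..s. k i)"
      "card ((\<Union>i\<in>{1..s}. set (P i)) \<inter> Y) \<le> (\<Sum>i=1..s. k i - 1)"
      by auto
    let ?U = "\<Union>i\<in>{1..s}. set (P i)"
    have kS: "1 \<le> k (Suc s)" using k Suc.prems by simp
    have "(\<Sum>i=1..Suc s. k i) \<le> (\<Sum>i=1..t. k i)" "(\<Sum>i=1..Suc s. k i - 1) \<le> (\<Sum>i=1..t. k i - 1)"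
      using Suc.prems by (intro sum_mono2; auto)+
    then have "card (?U \<inter> X) + Suc (k (Suc s) - 1) \<le> (\<Sum>i=1..t. k i)"
      "card (?U \<inter> Y) + (k (Suc s) - 1) \<le> (\<Sum>i=1..t. k i - 1)"
      using P kS by auto
    from alternating_path[OF assms(1-4) degX degY assms(7) this]
    obtain xs where xs: "path_in R (X \<union> Y) xs" "length xs = 2 * (k (Suc s) - 1) + 1" "hd xs \<in> X"
      "last xs \<in> X" "set xs \<inter> ?U = {}" "card (set xs \<inter> X) = Suc (k (Suc s) - 1)"
      "card (set xs \<inter> Y) = k (Suc s) - 1"
      by blast
    let ?P = "P(Suc s := xs)"
    have "path_system R (X \<union> Y) X (Suc s) k ?P"
    proof (rule path_system_extend[OF P(1) xs(1) _ xs(3,4)])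
      show "length xs = 2 * k (Suc s) - 1" using xs(2) kS by simp
      show "set xs \<inter> set (P i) = {}" if "i \<in> {1..s}" for i using xs(5) that by blast
    qed
    moreover have U: "(\<Union>i\<in>{1..Suc s}. set (?P i)) \<inter> Z = set xs \<inter> Z \<union> ?U \<inter> Z" for Z
      by (auto simp: atLeastAtMostSuc_conv)
    have "card ((\<Union>i\<in>{1..Suc s}. set (?P i)) \<inter> X) \<le> (\<Sum>i=1..Suc s. k i)"
      unfolding U using card_Un_le[of "set xs \<inter> X" "?U \<inter> X"] P(2) xs(6) kS by simp
    moreover have "card ((\<Union>i\<in>{1..Suc s}. set (?P i)) \<inter> Y) \<le> (\<Sum>i=1..Suc s. k i - 1)"
      unfolding U using card_Un_le[of "set xs \<inter> Y" "?U \<inter> Y"] P(3) xs(7) by simp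
    ultimately show ?case by blast
  qed
  then show ?thesis by blast
qed

section \<open>From path systems to intersecting cycles\<close>

text \<open>Both ends of each path are adjacent to \<open>v\<close>, so each closes to a cycle
  through \<open>v\<close>; disjointness lets the cycles meet only there.\<close>

lemma contains_int_cycles_if_path_system:
  assumes k: "\<And>i. i \<in> {1..t} \<Longrightarrow> 2 \<le> k i" and "v \<in> V"
    and P: "path_system (\<lambda>u w. {u, w} \<in> E) (V - {v}) {w. {v, w} \<in> E} t k P"
  shows "contains_subgraph V E (int_cycles_verts t k) (int_cycles_edges t k)"
proof -
  \<comment> \<open>Positions off the common vertex start at 1, list indices at 0; hence
    \<open>j - 1\<close>.\<close>
  define f where "f x = (case x of None \<Rightarrow> v | Some (i, j) \<Rightarrow> P i ! (j - 1))" for x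
  have path: "distinct (P i)" "successively (\<lambda>u w. {u, w} \<in> E) (P i)" "set (P i) \<subseteq> V - {v}"
    "length (P i) = 2 * k i - 1" "{v, hd (P i)} \<in> E" "{v, last (P i)} \<in> E"
    if "i \<in> {1..t}" for i
    using P that by (simp_all add: path_system_def path_in_def)
  have nonempty: "P i \<noteq> []" if "i \<in> {1..t}" for i
    using path(4)[OF that] k[OF that] by auto
  have disj: "set (P i) \<inter> set (P j) = {}" if "i \<in> {1..t}" "j \<in> {1..t}" "i \<noteq> j" for i j
    using P that by (auto simp: path_system_def)
  have verts: "x = None \<or> (\<exists>i j. x = Some (i, Suc j) \<and> i \<in> {1..t} \<and> j < length (P i))"
    if "x \<in> int_cycles_verts t k" for x
  proof -
    obtain i j where ij: "x = cyc_vertex k i j" "i \<in> {1..t}" "j < 2 * k i"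
      using \<open>x \<in> int_cycles_verts t k\<close> by (auto simp: int_cycles_verts_def)
    then show ?thesis using path(4)[OF ij(2)] by (cases j) (auto simp: cyc_vertex_def)
  qed
  have f: "f None = v" "f (Some (i, Suc j)) = P i ! j" for i j by (simp_all add: f_def)
  have in_path: "P i ! j \<in> set (P i)" "P i ! j \<in> V - {v}" if "i \<in> {1..t}" "j < length (P i)" for i j
    using path(3)[OF that(1)] nth_mem[OF that(2)] by auto
  have "inj_on f (int_cycles_verts t k)"
  proof (rule inj_onI)
    fix x y assume xy: "x \<in> int_cycles_verts t k" "y \<in> int_cycles_verts t k" "f x = f y"
    have "i = i' \<and> j = j'"
      if "i \<in> {1..t}" "j < length (P i)" "i' \<in> {1..t}" "j' < length (P i')" "P i ! j = P i' ! j'"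
      for i j i' j'
    proof -
      have "i = i'" using disj[OF that(1,3)] in_path[OF that(1,2)] in_path[OF that(3,4)] that(5) by auto
      then show ?thesis using path(1)[OF that(1)] that by (simp add: nth_eq_iff_index_eq)
    qed
    then show "x = y"
      using verts[OF xy(1)] verts[OF xy(2)] xy(3) in_path(2)
      by (elim disjE exE conjE) (simp_all add: f, (metis Diff_iff singletonI)+)
  qed
  moreover have "f ` int_cycles_verts t k \<subseteq> V"
    using verts in_path(2) \<open>v \<in> V\<close> f by fastforce
  moreover have "f ` e \<in> E" if "e \<in> int_cycles_edges t k" for e
  proof -
    obtain i j where e: "e = {cyc_vertex k i j, cyc_vertex k i (Suc j)}"
      and i: "i \<in> {1..t}" and j: "j < 2 * k i"
      using \<open>e \<in> int_cycles_edges t k\<close> unfolding int_cycles_edges_def by blast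
    note pi = path[OF i] nonempty[OF i]
    have ki: "2 \<le> k i" using k i by blast
    \<comment> \<open>The first edge leaves \<open>v\<close>, the last returns to it, and all others
      are edges of the path.\<close>
    show ?thesis
    proof (cases j)
      case 0
      then have "f ` e = {v, P i ! 0}" using e ki by (simp add: cyc_vertex_def f)
      then show ?thesis using pi by (simp add: hd_conv_nth)
    next
      case (Suc j')
      show ?thesis
      proof (cases "Suc j = 2 * k i")
        case True
        then have "f ` e = {v, P i ! j'}" using e ki Suc by (auto simp: cyc_vertex_def f)
        moreover have "j' = length (P i) - 1" using True Suc pi by simp
        ultimately show ?thesis using pi by (simp add: last_conv_nth)
      next
        case False
        then have "f ` e = {P i ! j', P i ! Suc j'}" using e j Suc by (simp add: cyc_vertex_def f)
        moreover have "Suc j' < length (P i)" using False Suc j pi by simp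
        ultimately show ?thesis using successively_nth[OF pi(2)] by simp
      qed
    qed
  qed
  ultimately show ?thesis unfolding contains_subgraph_def by blast
qed

section \<open>The sum of squared degrees\<close>

lemma vertex_degree_eq_card_nbrs:
  assumes "simple_graph V E"
  shows "vertex_degree E u = card (nbrs (\<lambda>u w. {u, w} \<in> E) V u)"
proof -
  have "{e \<in> E. u \<in> e} = (\<lambda>w. {u, w}) ` nbrs (\<lambda>u w. {u, w} \<in> E) V u"
  proof (intro equalityI subsetI)
    fix e assume "e \<in> {e \<in> E. u \<in> e}"
    then have e: "e \<in> E" "u \<in> e" "e \<subseteq> V" "card e = 2" using assms by (auto simp: simple_graph_def)
    then obtain a b where "e = {a, b}" by (auto simp: card_2_iff)
    then obtain w where "e = {u, w}" using e by auto
    then show "e \<in> (\<lambda>w. {u, w}) ` nbrs (\<lambda>u w. {u, w} \<in> E) V u" using e by (auto simp: nbrs_def)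
  qed (auto simp: nbrs_def)
  moreover have "inj_on (\<lambda>w. {u, w}) (nbrs (\<lambda>u w. {u, w} \<in> E) V u)"
    by (auto simp: inj_on_def doubleton_eq_iff)
  ultimately show ?thesis by (simp add: vertex_degree_def card_image)
qed

text \<open>The hypothesis \<open>2 \<le> n\<close> is present because for \<open>n \<le> 1\<close>
  both sides are 0 and the strict inequality fails.\<close>

theorem theorem3p6:
  fixes V :: "'a set" and E :: "'a set set"
    and t n \<kappa> :: nat and k :: "nat \<Rightarrow> nat"
  assumes "1 \<le> t"
    and "\<And>i. i \<in> {1..t} \<Longrightarrow> 2 \<le> k i"
    and "\<kappa> = (\<Sum>i=1..t. (k i - 1))"
    and "simple_graph V E"
    and "card V = n"
    and "2 \<le> n"
    and "\<not> contains_subgraph V E (int_cycles_verts t k) (int_cycles_edges t k)"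
  shows "(\<Sum>u\<in>V. (vertex_degree E u)\<^sup>2) < (4 * \<kappa> + t) * (n - 1) * n"
proof -
  define R where "R = (\<lambda>u w. {u, w} \<in> E)"
  have fin: "finite V" using assms(4) by (simp add: simple_graph_def)
  have sym: "symp R" by (auto simp: symp_def R_def insert_commute)
  have irr: "irreflp R" using assms(4) by (fastforce simp: irreflp_def R_def simple_graph_def)
  have deg: "vertex_degree E u = card (nbrs R V u)" for u
    unfolding R_def by (rule vertex_degree_eq_card_nbrs[OF assms(4)])
  have ksum: "(\<Sum>i=1..t. k i) = \<kappa> + t"
  proof -
    have "(\<Sum>i=1..t. k i) = (\<Sum>i=1..t. (k i - 1) + 1)"
      using assms(2) by (intro sum.cong) force+
    then show ?thesis unfolding assms(3) sum.distrib by simp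
  qed
  have ksum2: "(\<Sum>i=1..t. 2 * k i - 1) = 2 * \<kappa> + t"
  proof -
    have "(\<Sum>i=1..t. 2 * k i - 1) = (\<Sum>i=1..t. 2 * (k i - 1) + 1)"
      using assms(2) by (intro sum.cong) force+
    then show ?thesis unfolding assms(3) sum.distrib by (simp add: sum_distrib_left)
  qed
  \<comment> \<open>This makes the truncated subtractions in the bounds below exact.\<close>
  have "\<kappa> \<ge> 1"
  proof -
    have "k 1 - 1 \<le> \<kappa>" unfolding assms(3) by (rule member_le_sum) (use assms(1) in auto)
    then show ?thesis using assms(2)[of 1] assms(1) by simp
  qed
  have no_system: False if "v \<in> V" "path_system R S A t k P" "S \<subseteq> V - {v}" "A \<subseteq> nbrs R V v" for v S A P
  proof -
    have "path_system R (V - {v}) {w. {v, w} \<in> E} t k P"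
      using that by (intro path_system_mono[OF that(2)]) (auto simp: nbrs_def R_def)
    then show False
      using contains_int_cycles_if_path_system[of t k v V E P] assms(2,7) that(1)
      unfolding R_def by blast
  qed
  have bound: "(\<Sum>u\<in>nbrs R V v. card (nbrs R V u)) < (4 * \<kappa> + t) * (n - 1)" if v: "v \<in> V" for v
  proof -
    define A where "A = nbrs R V v"
    define B where "B = V - {v} - A"
    have vA: "v \<notin> A" using irr by (auto simp: A_def nbrs_def irreflp_def)
    have AV: "A \<subseteq> V - {v}" using vA by (auto simp: A_def nbrs_def)
    have finAB: "finite A" "finite B" using fin by (auto simp: A_def B_def)
    have AB: "A \<inter> B = {}" "V = (A \<union> B) \<union> {v}" "v \<notin> A \<union> B" using AV v by (auto simp: B_def)
    have "card V = card (A \<union> B) + card {v}"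
      unfolding AB(2) by (rule card_Un_disjoint) (use finAB AB(3) in auto)
    then have card: "card A + card B = n - 1"
      using assms(5) finAB AB(1) by (simp add: card_Un_disjoint)
    \<comment> \<open>The summand 1 is the edge from \<open>u\<close> back to
      \<open>v\<close>.\<close>
    have "card (nbrs R V u) = card (nbrs R A u) + card (nbrs R B u) + 1" if "u \<in> A" for u
    proof -
      have "R u v" using that sym by (auto simp: A_def nbrs_def dest: sympD)
      then show ?thesis
        using card_nbrs_Un[of "A \<union> B" "{v}" R u] card_nbrs_Un[of A B R u] card_nbrs_singleton[of R v u]
          finAB AB by simp
    qed
    then have total: "(\<Sum>u\<in>A. card (nbrs R V u))
        = (\<Sum>u\<in>A. card (nbrs R A u)) + (\<Sum>u\<in>A. card (nbrs R B u)) + card A"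
      by (simp add: sum.distrib sum_Suc)
    \<comment> \<open>Erdos-Gallai with \<open>m = 2 * \<kappa> + t - 1\<close>, one less than the
      total number of vertices on the required paths.\<close>
    have "(\<Sum>u\<in>A. card (nbrs R A u)) \<le> (2 * \<kappa> + t - 1 - 1) * card A"
    proof (rule erdos_gallai_path[OF sym irr finAB(1)])
      show "1 \<le> 2 * \<kappa> + t - 1" using \<open>\<kappa> \<ge> 1\<close> by simp
      fix xs assume xs: "path_in R A xs"
      show "length xs \<le> 2 * \<kappa> + t - 1"
      proof (rule ccontr)
        assume "\<not> length xs \<le> 2 * \<kappa> + t - 1"
        then have "(\<Sum>i=1..t. 2 * k i - 1) \<le> length xs" unfolding ksum2 by simp
        then obtain P where "path_system R A A t k P"
          using path_system_from_long_path[of t k R A xs] xs assms(2) by fastforce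
        then show False using no_system[OF v] AV by (auto simp: A_def)
      qed
    qed
    moreover have "(\<Sum>u\<in>A. card (nbrs R B u)) \<le> (\<kappa> - 1) * card A + (\<kappa> + t - 1) * card B"
    proof (rule ccontr)
      assume "\<not> ?thesis"
      then obtain X Y where XY: "X \<subseteq> A" "Y \<subseteq> B" "X \<noteq> {}"
        "\<And>x. x \<in> X \<Longrightarrow> \<kappa> - 1 < card (nbrs R Y x)" "\<And>y. y \<in> Y \<Longrightarrow> \<kappa> + t - 1 < card (nbrs R X y)"
        using bipartite_min_degree_subgraph[OF sym finAB] by (metis not_le)
      have fXY: "finite X" "finite Y" using XY(1,2) finAB by (auto intro: finite_subset)
      have dX: "(\<Sum>i=1..t. k i - 1) \<le> card (nbrs R Y x)" if "x \<in> X" for x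
        using XY(4)[OF that] assms(3) by simp
      have dY: "(\<Sum>i=1..t. k i) \<le> card (nbrs R X y)" if "y \<in> Y" for y
        using XY(5)[OF that] ksum by simp
      obtain x where "x \<in> X" using XY by blast
      then have "nbrs R Y x \<noteq> {}" using XY(4)[of x] by auto
      then obtain y where "y \<in> Y" by (auto simp: nbrs_def)
      \<comment> \<open>A single vertex of \<open>Y\<close> already has that many neighbours in
        \<open>X\<close>.\<close>
      then have "(\<Sum>i=1..t. k i) \<le> card X"
        using dY[of y] card_mono[of X "nbrs R X y"] fXY by (force simp: nbrs_def)
      moreover have "X \<inter> Y = {}" using XY(1,2) AB(1) by blast
      moreover have "1 \<le> k i" if "i \<in> {1..t}" for i using assms(2)[OF that] by simp
      ultimately obtain P where "path_system R (X \<union> Y) X t k P"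
        using path_system_bipartite[OF sym fXY _ dX dY] by blast
      moreover have "X \<union> Y \<subseteq> V - {v}" "X \<subseteq> nbrs R V v" using XY AV B_def A_def by auto
      ultimately show False using no_system[OF v] by blast
    qed
    ultimately have "(\<Sum>u\<in>A. card (nbrs R V u))
        \<le> (2 * \<kappa> + t - 1 - 1 + (\<kappa> - 1) + 1) * card A + (\<kappa> + t - 1) * card B"
      unfolding total by (simp add: algebra_simps)
    \<comment> \<open>The coefficients are \<open>3 * \<kappa> + t - 2\<close> and
      \<open>\<kappa> + t - 1\<close>. Stopping at \<open>4 * \<kappa> + t - 1\<close> leaves room
      for the strict inequality, as \<open>n - 1\<close> is positive.\<close>
    also have "\<dots> \<le> (4 * \<kappa> + t - 1) * card A + (4 * \<kappa> + t - 1) * card B"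
      by (intro add_mono mult_right_mono) (use \<open>\<kappa> \<ge> 1\<close> in auto)
    also have "\<dots> = (4 * \<kappa> + t - 1) * (n - 1)" unfolding card[symmetric] by (rule distrib_left[symmetric])
    also have "\<dots> < (4 * \<kappa> + t) * (n - 1)" using assms(1,6) by simp
    finally show ?thesis by (simp add: A_def)
  qed
  have "(\<Sum>u\<in>V. (vertex_degree E u)\<^sup>2) = (\<Sum>u\<in>V. \<Sum>v\<in>V. if R u v then card (nbrs R V u) else 0)"
    using fin by (simp add: deg power2_eq_square sum.If_cases nbrs_def Int_def)
  also have "\<dots> = (\<Sum>v\<in>V. \<Sum>u\<in>V. if R v u then card (nbrs R V u) else 0)"
    using sym by (subst sum.swap) (auto intro!: sum.cong dest: sympD)
  also have "\<dots> = (\<Sum>v\<in>V. \<Sum>u\<in>nbrs R V v. card (nbrs R V u))"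
    using fin by (simp add: sum.If_cases nbrs_def Int_def)
  also have "\<dots> < (\<Sum>v\<in>V. (4 * \<kappa> + t) * (n - 1))"
    using bound fin assms(5,6) by (intro sum_strict_mono) auto
  also have "\<dots> = (4 * \<kappa> + t) * (n - 1) * n" using assms(5) by simp
  finally show ?thesis .
qed

end
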